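(* Let $n\ge 3$. For any $n$-gon center function $f$, every regular $n$-gon (convex or star) $(V_1,\ldots,V_n)$ satisfies $$f(V_1,\ldots,V_n)=f(V_2,\ldots,V_n,V_1)=\ldots=f(V_n,V_1,\ldots,V_{n-1}),$$ so, if defined, $\varphi_f(V_1,\ldots,V_n)=[1:\ldots:1]$.
   Context: An $n$-gon is identified with a tuple $(V_1,\ldots,V_n)$ of points of $\mathbb R^2$ (its labelled vertices), the edges being the segments $V_iV_{i+1}$ (indices mod $n$, taken in $\{1,\ldots,n\}$). The set of all $n$-gons is $\mathcal P_n\approx(\mathbb R^2)^n$; center functions may also be considered on a restricted domain, such as the non-degenerated $n$-gons (no two vertices coincide) or the convex $n$-gons; in that case the identities are required for $n$-gons in the domain. A regular $n$-gon is one that is equiangular and equilateral; regular $n$-gons can be either convex or star (the usual regular convex or regular star polygons). Let $\sigma$ be the permutation of $\{1,\ldots,n\}$ given by $\sigma(i)=2+n-i \bmod n$ (so $\sigma(1)=1$). An $n$-gon center function is a real-valued function $f(V_1,\ldots,V_n)$ such that: (1) $f(V_1,V_2,\ldots,V_n)=f(V_1,V_{\sigma(2)},\ldots,V_{\sigma(n)})$; (2) there is $k\in\mathbb N$ (with $0\in\mathbb N$) such that $f(tV_1,\ldots,tV_n)=t^kf(V_1,\ldots,V_n)$ for all $t\in\mathbb R_{\ge 0}$; (3) $f(T(V_1),\ldots,T(V_n))=f(V_1,\ldots,V_n)$ for every rigid motion (isometry) $T$ of the plane. Its coordinate map, with values in the real projective space $P_{n-1}\mathbb R$, is $$\varphi_f(V_1,\ldots,V_n)=[f(V_1,\ldots,V_n):f(V_2,\ldots,V_n,V_1):\ldots:f(V_n,V_1,\ldots,V_{n-1})],$$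 which is undefined when all these entries are zero. *)

theory Defs
  imports "HOL-Analysis.Analysis"
begin

text \<open>An \<open>n\<close>-gon \<open>(V\<^sub>1, \<dots>, V\<^sub>n)\<close> is a list of length \<open>n\<close>; the vertex \<open>V\<^sub>i\<close> is the list
  entry \<open>V ! (i - 1)\<close>.  Vertices may coincide.  The tuple \<open>(V\<^sub>1\<^sub>+\<^sub>k, \<dots>, V\<^sub>n, V\<^sub>1, \<dots>, V\<^sub>k)\<close> is
  \<open>rotate k V\<close>.\<close>

type_synonym ngon = "(real ^ 2) list"

definition ngons :: "nat \<Rightarrow> ngon set" where
  "ngons n = {V. length V = n}"

text \<open>The residue class of \<open>2 + n - i\<close> modulo \<open>n\<close> is represented in \<open>{1..n}\<close>.\<close>

definition sigma :: "nat \<Rightarrow> nat \<Rightarrow> nat" where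
  "sigma n i = (let r = (2 + n - i) mod n in if r = 0 then n else r)"

definition relabel :: "(nat \<Rightarrow> nat) \<Rightarrow> ngon \<Rightarrow> ngon" where
  "relabel \<pi> V = map (\<lambda>i. V ! (\<pi> i - 1)) [1..<Suc (length V)]"

text \<open>Isometries of the plane are automatically bijective.  Orientation-reversing ones are
  included.\<close>

definition rigid_motion :: "(real ^ 2 \<Rightarrow> real ^ 2) \<Rightarrow> bool" where
  "rigid_motion T \<longleftrightarrow> (\<forall>x y. dist (T x) (T y) = dist x y)"

text \<open>A domain on which center functions are considered.  It must contain the cyclic relabellings
  of its members, since the coordinate map evaluates the function at all of them.\<close>

definition ngon_domain :: "nat \<Rightarrow> ngon set \<Rightarrow> bool" where
  "ngon_domain n D \<longleftrightarrow> D \<subseteq> ngons n \<and> (\<forall>V\<in>D. rotate1 V \<in> D)"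

text \<open>The values of \<open>f\<close> outside \<open>D\<close> are irrelevant: each identity is required only when the
  \<open>n\<close>-gons on both of its sides lie in \<open>D\<close> (for example, the non-degenerate \<open>n\<close>-gons are not closed
  under scaling by \<open>0\<close>).\<close>

definition center_function :: "nat \<Rightarrow> ngon set \<Rightarrow> (ngon \<Rightarrow> real) \<Rightarrow> bool" where
  "center_function n D f \<longleftrightarrow>
     (\<forall>V\<in>D. relabel (sigma n) V \<in> D \<longrightarrow> f V = f (relabel (sigma n) V)) \<and>
     (\<exists>k::nat. \<forall>t\<ge>0. \<forall>V\<in>D. map (\<lambda>v. t *\<^sub>R v) V \<in> D \<longrightarrow> f (map (\<lambda>v. t *\<^sub>R v) V) = t ^ k * f V) \<and>
     (\<forall>T. rigid_motion T \<longrightarrow> (\<forall>V\<in>D. map T V \<in> D \<longrightarrow> f (map T V) = f V))"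

definition plane_to_complex :: "real ^ 2 \<Rightarrow> complex" where
  "plane_to_complex v = Complex (v $ 1) (v $ 2)"

text \<open>The angle in \<open>[0, 2\<pi>)\<close> by which the direction of \<open>u\<close> must be turned counterclockwise to give
  that of \<open>v\<close>; it is meaningful only for nonzero \<open>u\<close> and \<open>v\<close>.\<close>

definition oriented_angle :: "real ^ 2 \<Rightarrow> real ^ 2 \<Rightarrow> real" where
  "oriented_angle u v = Arg2pi (plane_to_complex v / plane_to_complex u)"

text \<open>The angle at a vertex, counterclockwise from the outgoing to the incoming edge.  For a simple
  polygon labelled counterclockwise this is the interior angle, for one labelled clockwise it is
  \<open>2\<pi>\<close> minus the interior angle.  The unoriented angle would not do: it does not distinguish
  interior angles \<open>\<theta>\<close> and \<open>2\<pi> - \<theta>\<close>, and so would make the cross-shaped 12-gon with right angles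
  equiangular.\<close>

definition vertex_angle :: "ngon \<Rightarrow> nat \<Rightarrow> real" where
  "vertex_angle V i =
     (let n = length V; A = V ! ((i + n - 1) mod n); B = V ! i; C = V ! (Suc i mod n)
      in oriented_angle (C - B) (A - B))"

definition equiangular :: "ngon \<Rightarrow> bool" where
  "equiangular V \<longleftrightarrow> (\<exists>\<theta>. \<forall>i<length V. vertex_angle V i = \<theta>)"

text \<open>The common side length is positive, so that all vertex angles are meaningful.\<close>

definition equilateral :: "ngon \<Rightarrow> bool" where
  "equilateral V \<longleftrightarrow> (\<exists>s>0. \<forall>i<length V. dist (V ! i) (V ! (Suc i mod length V)) = s)"

definition regular_ngon :: "ngon \<Rightarrow> bool" where
  "regular_ngon V \<longleftrightarrow> equilateral V \<and> equiangular V"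

text \<open>Real projective space of dimension \<open>n - 1\<close> is \<open>hom_vectors n // proj_rel n\<close>, and
  \<open>[x\<^sub>1 : \<dots> : x\<^sub>n]\<close> is \<open>proj_point [x\<^sub>1, \<dots>, x\<^sub>n]\<close>.\<close>

definition hom_vectors :: "nat \<Rightarrow> real list set" where
  "hom_vectors n = {x. length x = n \<and> (\<exists>a\<in>set x. a \<noteq> 0)}"

definition proj_rel :: "nat \<Rightarrow> (real list \<times> real list) set" where
  "proj_rel n = {(x, y). x \<in> hom_vectors n \<and> y \<in> hom_vectors n \<and> (\<exists>c. c \<noteq> 0 \<and> y = map (\<lambda>a. c * a) x)}"

definition proj_point :: "real list \<Rightarrow> real list set" where
  "proj_point x = proj_rel (length x) `` {x}"

definition coordinate_map :: "(ngon \<Rightarrow> real) \<Rightarrow> ngon \<Rightarrow> real list set option" where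
  "coordinate_map f V =
     (let x = map (\<lambda>k. f (rotate k V)) [0..<length V]
      in if \<forall>a\<in>set x. a = 0 then None else Some (proj_point x))"

lemma relabel_sigma:
  assumes "V \<noteq> []"
  shows "relabel (sigma (length V)) V = hd V # rev (tl V)"
proof (rule nth_equalityI)
  show "length (relabel (sigma (length V)) V) = length (hd V # rev (tl V))"
    using assms by (simp add: relabel_def Suc_le_eq del: upt_Suc)
next
  fix i assume "i < length (relabel (sigma (length V)) V)"
  then have i: "i < length V" by (simp add: relabel_def del: upt_Suc)
  show "relabel (sigma (length V)) V ! i = (hd V # rev (tl V)) ! i"
  proof (cases i)
    case 0
    have "sigma (length V) 1 - 1 = 0"
      using i by (cases "length V = 1") (auto simp: sigma_def Let_def mod_Suc)
    then show ?thesis using 0 i assms by (simp add: relabel_def hd_conv_nth del: upt_Suc)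
  next
    case (Suc j)
    have "sigma (length V) (Suc i) - 1 = length V - i"
      using Suc i by (cases "j = 0") (auto simp: sigma_def Let_def)
    moreover have "rev (tl V) ! j = V ! (length V - i)"
      using Suc i by (simp add: rev_nth nth_tl Suc_diff_Suc)
    ultimately show ?thesis using Suc i by (simp add: relabel_def del: upt_Suc)
  qed
qed

lemma equiv_proj_rel: "equiv (hom_vectors n) (proj_rel n)"
proof (rule equivI)
  show "proj_rel n \<subseteq> hom_vectors n \<times> hom_vectors n"
    by (auto simp: proj_rel_def)
  show "refl_on (hom_vectors n) (proj_rel n)"
    by (auto simp: refl_on_def proj_rel_def map_idI intro!: exI[of _ 1])
  show "sym (proj_rel n)"
  proof (rule symI)
    fix x y assume "(x, y) \<in> proj_rel n"
    then obtain c where c: "x \<in> hom_vectors n" "y \<in> hom_vectors n" "c \<noteq> 0" "y = map (\<lambda>a. c * a) x"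
      by (auto simp: proj_rel_def)
    then have "x = map (\<lambda>a. inverse c * a) y"
      by (simp add: o_def mult.assoc[symmetric])
    then show "(y, x) \<in> proj_rel n"
      unfolding proj_rel_def using c by (auto intro!: exI[of _ "inverse c"])
  qed
  show "trans (proj_rel n)"
  proof (rule transI)
    fix x y z assume "(x, y) \<in> proj_rel n" "(y, z) \<in> proj_rel n"
    then obtain c d where "x \<in> hom_vectors n" "z \<in> hom_vectors n" "c \<noteq> 0" "d \<noteq> 0"
      "z = map (\<lambda>a. (d * c) * a) x"
      by (auto simp: proj_rel_def o_def mult.assoc)
    then show "(x, z) \<in> proj_rel n"
      unfolding proj_rel_def by (auto intro!: exI[of _ "d * c"])
  qed
qed

lemma ngon_domain_ngons: "ngon_domain n (ngons n)"
  by (auto simp: ngon_domain_def ngons_def)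

lemma ngon_domain_nondegenerate: "ngon_domain n {V \<in> ngons n. distinct V}"
  by (auto simp: ngon_domain_def ngons_def)

end

theory Submission
  imports Defs
begin

text \<open>Identify the plane with \<open>\<complex>\<close> and let \<open>e\<^sub>i\<close> be the edge from \<open>V\<^sub>i\<close> to \<open>V\<^sub>i\<^sub>+\<^sub>1\<close>.  In a regular
  polygon all quotients \<open>- e\<^sub>i / e\<^sub>i\<^sub>+\<^sub>1\<close> have modulus \<open>1\<close> and the same argument, so \<open>e\<^sub>i\<^sub>+\<^sub>1 = w e\<^sub>i\<close>
  for one fixed \<open>w\<close> on the unit circle.  By induction along the polygon, the rigid motion
  \<open>z \<mapsto> w (z - V\<^sub>1) + V\<^sub>2\<close> sends each vertex to the next one, so the invariance of \<open>f\<close> under rigid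
  motions makes \<open>f\<close> invariant under cyclic relabelling.\<close>

definition complex_to_plane :: "complex \<Rightarrow> real ^ 2" where
  "complex_to_plane z = vector [Re z, Im z]"

lemma plane_to_complex_inverse [simp]: "plane_to_complex (complex_to_plane z) = z"
  by (simp add: plane_to_complex_def complex_to_plane_def)

lemma complex_to_plane_inverse [simp]: "complex_to_plane (plane_to_complex v) = v"
  by (simp add: plane_to_complex_def complex_to_plane_def vec_eq_iff forall_2)

lemma plane_to_complex_diff: "plane_to_complex (u - v) = plane_to_complex u - plane_to_complex v"
  by (simp add: plane_to_complex_def complex_eq_iff)

lemma norm_plane_to_complex [simp]: "norm (plane_to_complex v) = norm v"
  by (simp add: plane_to_complex_def cmod_def norm_vec_def L2_set_def sum_2)

lemma dist_plane_to_complex: "dist (plane_to_complex u) (plane_to_complex v) = dist u v"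
  by (simp add: dist_norm flip: plane_to_complex_diff)

lemma dist_complex_to_plane: "dist (complex_to_plane u) (complex_to_plane v) = dist u v"
  by (simp flip: dist_plane_to_complex)

lemma rigid_motion_rotation:
  assumes "norm w = 1"
  shows "rigid_motion (\<lambda>v. complex_to_plane (w * (plane_to_complex v - a) + b))"
proof -
  have "dist (w * (y - a) + b) (w * (z - a) + b) = dist y z" for y z
  proof -
    have "w * (y - a) + b - (w * (z - a) + b) = w * (y - z)"
      by (simp add: algebra_simps)
    then show ?thesis
      using assms by (simp add: dist_norm norm_mult)
  qed
  then show ?thesis
    by (simp add: rigid_motion_def dist_complex_to_plane dist_plane_to_complex)
qed

text \<open>With indices reduced modulo the length, the recurrence covers the closing edge without a
  separate case.\<close>

lemma regular_ngon_edge_ratio: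
  fixes V :: ngon
  defines "z \<equiv> \<lambda>i. plane_to_complex (V ! (i mod length V))"
  assumes "V \<noteq> []" and "regular_ngon V"
  obtains w where "norm w = 1" and "\<And>i. z (Suc (Suc i)) - z (Suc i) = w * (z (Suc i) - z i)"
proof -
  let ?n = "length V"
  have n: "?n > 0" using assms by simp
  obtain s where s: "s > 0" "\<And>i. i < ?n \<Longrightarrow> dist (V ! i) (V ! (Suc i mod ?n)) = s"
    using assms(3) unfolding regular_ngon_def equilateral_def by auto
  obtain \<theta> where \<theta>: "\<And>i. i < ?n \<Longrightarrow> vertex_angle V i = \<theta>"
    using assms(3) unfolding regular_ngon_def equiangular_def by auto
  have edge: "norm (z (Suc i) - z i) = s" for i
    using s(2)[of "i mod ?n"] n
    by (simp add: z_def dist_norm norm_minus_commute mod_Suc_eq flip: plane_to_complex_diff)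
  \<comment> \<open>Turning the outgoing edge by \<theta> gives the reversed incoming edge, of the
    same length; solving for the outgoing edge yields the factor
    \<open>- cis (- \<theta>)\<close>.\<close>
  have turn: "z (Suc (Suc i)) - z (Suc i) = - cis (- \<theta>) * (z (Suc i) - z i)" for i
  proof -
    let ?q = "(z i - z (Suc i)) / (z (Suc (Suc i)) - z (Suc i))"
    have prev: "(Suc i mod ?n + ?n - 1) mod ?n = i mod ?n"
      using n by (simp add: mod_Suc) linarith
    have "vertex_angle V (Suc i mod ?n) = Arg2pi ?q"
      unfolding vertex_angle_def oriented_angle_def Let_def prev z_def
      by (simp add: plane_to_complex_diff mod_Suc_eq)
    then have "Arg2pi ?q = \<theta>" using \<theta>[of "Suc i mod ?n"] n by simp
    moreover have "norm ?q = 1"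
      using s(1) edge by (simp add: norm_divide norm_minus_commute[of "z i"])
    ultimately have "?q = cis \<theta>"
      using Arg2pi_eq[of ?q] by (simp add: cis_conv_exp)
    \<comment> \<open>The denominator of \<open>?q\<close> can be cleared only because
      \<open>s > 0\<close> excludes division by zero.\<close>
    moreover have "z (Suc (Suc i)) - z (Suc i) \<noteq> 0"
      using edge[of "Suc i"] s(1) by auto
    ultimately have "z i - z (Suc i) = cis \<theta> * (z (Suc (Suc i)) - z (Suc i))"
      by (simp add: divide_eq_eq)
    then have "cis (- \<theta>) * (z i - z (Suc i)) = z (Suc (Suc i)) - z (Suc i)"
      by (simp add: mult.assoc[symmetric] cis_mult)
    then show ?thesis by (simp add: algebra_simps)
  qed
  show thesis by (rule that[OF _ turn]) simp
qed

lemma regular_ngon_rotate1: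
  assumes "V \<noteq> []" and "regular_ngon V"
  obtains T where "rigid_motion T" and "map T V = rotate1 V"
proof -
  let ?n = "length V"
  define z where "z i = plane_to_complex (V ! (i mod ?n))" for i
  obtain w where w: "norm w = 1" "\<And>i. z (Suc (Suc i)) - z (Suc i) = w * (z (Suc i) - z i)"
    using regular_ngon_edge_ratio[OF assms] unfolding z_def by blast
  \<comment> \<open>The affine map takes \<open>z 0\<close> to \<open>z 1\<close> and multiplies
    differences by \<open>w\<close>, so it carries each edge to the next. Since \<open>z\<close> is
    periodic, the last vertex goes to the first.\<close>
  have step: "w * (z i - z 0) + z 1 = z (Suc i)" for i
  proof (induction i)
    case (Suc i)
    have "w * (z (Suc i) - z 0) + z 1 = (w * (z i - z 0) + z 1) + w * (z (Suc i) - z i)"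
      by (simp add: algebra_simps)
    then show ?case unfolding Suc.IH by (simp flip: w(2))
  qed simp
  define T where "T v = complex_to_plane (w * (plane_to_complex v - z 0) + z 1)" for v
  have "map T V = rotate1 V"
  proof (rule nth_equalityI)
    fix i assume "i < length (map T V)"
    then have i: "i < ?n" by simp
    have "T (V ! i) = complex_to_plane (w * (z i - z 0) + z 1)"
      using i by (simp add: T_def z_def)
    also have "\<dots> = V ! (Suc i mod ?n)"
      unfolding step by (simp add: z_def)
    finally show "map T V ! i = rotate1 V ! i"
      using i by (simp add: nth_rotate1)
  qed simp
  moreover have "rigid_motion T"
    unfolding T_def using w(1) by (rule rigid_motion_rotation)
  ultimately show thesis using that by blast
qed

text \<open>The entry \<open>c\<close> itself is the scalar relating the all-ones vector to the
  constant one.\<close>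

lemma proj_point_replicate:
  assumes "n > 0" and "c \<noteq> 0"
  shows "proj_point (replicate n c) = proj_point (replicate n 1)"
proof -
  have "(replicate n 1, replicate n c) \<in> proj_rel n"
    using assms by (auto simp: proj_rel_def hom_vectors_def intro!: exI[of _ c])
  then show ?thesis
    using equiv_class_eq[OF equiv_proj_rel] by (fastforce simp: proj_point_def)
qed

theorem proposition11:
  fixes n :: nat and D :: "ngon set" and f :: "ngon \<Rightarrow> real" and V :: ngon
  assumes "n \<ge> 3"
    and "ngon_domain n D"
    and "center_function n D f"
    and "V \<in> D"
    and "regular_ngon V"
  shows "(\<forall>k<n. f (rotate k V) = f V) \<and>
    (coordinate_map f V \<noteq> None \<longrightarrow> coordinate_map f V = Some (proj_point (replicate n 1)))"
proof -
  have len: "length V = n" and rot: "\<And>W. W \<in> D \<Longrightarrow> rotate1 W \<in> D"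
    using assms by (auto simp: ngon_domain_def ngons_def)
  then have "V \<noteq> []" using assms(1) by auto
  then obtain T where T: "rigid_motion T" "map T V = rotate1 V"
    using regular_ngon_rotate1 assms(5) by blast
  \<comment> \<open>Invariance under rigid motions is available only between members of
    \<open>D\<close>.\<close>
  have inD: "rotate k V \<in> D" for k
    by (induction k) (simp_all add: assms(4) rot)
  have eq: "f (rotate k V) = f V" for k
  proof (induction k)
    case (Suc k)
    \<comment> \<open>\<open>map\<close> commutes with list rotation, so the one \<open>T\<close>
      found for \<open>V\<close> serves all its relabellings.\<close>
    have "map T (rotate k V) = rotate (Suc k) V"
      using T(2) by (simp add: rotate_map[symmetric] rotate1_rotate_swap)
    then have "f (rotate (Suc k) V) = f (rotate k V)"
      using assms(3) T(1) inD unfolding center_function_def by metis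
    then show ?case using Suc by simp
  qed simp
  \<comment> \<open>Hence \<open>coordinate_map f V\<close> is undefined exactly when
    \<open>f V\<close> is 0.\<close>
  have "map (\<lambda>k. f (rotate k V)) [0..<length V] = replicate n (f V)"
    unfolding eq len by (simp add: map_replicate_const)
  then show ?thesis
    using eq proj_point_replicate[of n "f V"] assms(1)
    by (auto simp: coordinate_map_def Let_def)
qed

end
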